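(* Let $J$ be one of the intervals $I_\tau,J_\top,J_+$ and let $\otimes$ be $\times$ or $\boxplus$. Let $f,g:(X,c_X)\to(Y,c_Y)$ be continuous maps of closure spaces. If $f\sim_{(J,\otimes)}g$, then $f_*=g_*:H^{(J,\otimes)}_n(X,c_X)\to H^{(J,\otimes)}_n(Y,c_Y)$ for all $n\ge0$.
   Context: A (Čech) closure space $(X,c)$ is a set $X$ with a function $c:2^X\to 2^X$ such that $c(\varnothing)=\varnothing$, $A\subset c(A)$, and $c(A\cup B)=c(A)\cup c(B)$. Write $c(x)$ for $c(\{x\})$. A map $f:(X,c_X)\to(Y,c_Y)$ is continuous if $f(c_X(A))\subset c_Y(f(A))$ for all $A\subset X$. A set $U$ is a neighborhood of $x$ if $x\notin c(X\setminus U)$. Products on $X\times Y$: $(c_X\times c_Y)(A)=\{(x,y)\mid (U\times V)\cap A\neq\varnothing$ for all neighborhoods $U$ of $x$, $V$ of $y\}$; $(c_X\boxplus c_Y)(A)=\{(x,y)\mid ((\{x\}\times V)\cup(U\times\{y\}))\cap A\neq\varnothing$ for all neighborhoods $U$ of $x$, $V$ of $y\}$. Intervals: $I_\tau=[0,1]$ with the closure of its standard topology; $J_\top=\{0,1\}$ with the indiscrete closure ($c(A)=\{0,1\}$ for $A\neq\varnothing$); $J_+=\{0,1\}$ with $c(0)=\{0,1\}$, $c(1)=\{1\}$. An elementary $(J,\otimes)$ homotopy from $f$ to $g$ is a continuous map $H:X\otimes J\to Y$ with $H(x,0)=f(x)$, $H(x,1)=g(x)$; $\sim_{(J,\otimes)}$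 is the equivalence relation on continuous maps $X\to Y$ generated by elementary $(J,\otimes)$ homotopies. Cubical singular homology: the $(J,\otimes)$ $n$-cube is $|\Box^n|=J^{\otimes n}$ ($n$-fold product; one point if $n=0$). A singular $n$-cube in $X$ is a continuous map $\sigma:|\Box^n|\to X$. For $1\le i\le n$ and $\epsilon\in\{0,1\}$ put $d^n_{i,\epsilon}(\sigma)(a_1,\dots,a_{n-1})=\sigma(a_1,\dots,a_{i-1},\epsilon,a_i,\dots,a_{n-1})$. $\sigma$ is degenerate if $d^n_{i,0}\sigma=d^n_{i,1}\sigma$ for some $i$. $C_n^{(J,\otimes)}(X)$ is the free abelian group on singular $n$-cubes modulo the free abelian group on degenerate ones, with boundary $\partial_n\sigma=\sum_{i=1}^n(-1)^i(d^n_{i,0}\sigma-d^n_{i,1}\sigma)$. $H_n^{(J,\otimes)}(X)$ is the homology of this chain complex; a continuous map $f$ induces $f_*$ by $\sigma\mapsto f\circ\sigma$. *)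

theory Defs
  imports "HOL-Analysis.Analysis" "HOL-Algebra.Free_Abelian_Groups"
begin

section \<open>Closure spaces\<close>

text \<open>A closure space is given by an explicit (possibly empty) point set, and its closure operation
  is only meaningful on subsets of that point set.\<close>

datatype 'a cspace = CSpace (pts: "'a set") (cl: "'a set \<Rightarrow> 'a set")

definition closure_space :: "'a cspace \<Rightarrow> bool" where
  "closure_space X \<longleftrightarrow>
     cl X {} = {} \<and>
     (\<forall>A \<subseteq> pts X. A \<subseteq> cl X A \<and> cl X A \<subseteq> pts X) \<and>
     (\<forall>A B. A \<subseteq> pts X \<longrightarrow> B \<subseteq> pts X \<longrightarrow> cl X (A \<union> B) = cl X A \<union> cl X B)"

definition ccontinuous :: "'a cspace \<Rightarrow> 'b cspace \<Rightarrow> ('a \<Rightarrow> 'b) \<Rightarrow> bool" where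
  "ccontinuous X Y f \<longleftrightarrow>
     f ` pts X \<subseteq> pts Y \<and> (\<forall>A \<subseteq> pts X. f ` cl X A \<subseteq> cl Y (f ` A))"

definition neighborhood :: "'a cspace \<Rightarrow> 'a \<Rightarrow> 'a set \<Rightarrow> bool" where
  "neighborhood X x U \<longleftrightarrow> x \<in> pts X \<and> U \<subseteq> pts X \<and> x \<notin> cl X (pts X - U)"

definition cross_prod :: "'a cspace \<Rightarrow> 'b cspace \<Rightarrow> ('a \<times> 'b) cspace" where
  "cross_prod X Y = CSpace (pts X \<times> pts Y)
     (\<lambda>A. {(x, y). x \<in> pts X \<and> y \<in> pts Y \<and>
        (\<forall>U V. neighborhood X x U \<longrightarrow> neighborhood Y y V \<longrightarrow> (U \<times> V) \<inter> A \<noteq> {})})"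

definition box_prod :: "'a cspace \<Rightarrow> 'b cspace \<Rightarrow> ('a \<times> 'b) cspace" where
  "box_prod X Y = CSpace (pts X \<times> pts Y)
     (\<lambda>A. {(x, y). x \<in> pts X \<and> y \<in> pts Y \<and>
        (\<forall>U V. neighborhood X x U \<longrightarrow> neighborhood Y y V \<longrightarrow>
           (({x} \<times> V) \<union> (U \<times> {y})) \<inter> A \<noteq> {})})"

text \<open>The choice of product is a datatype, since the same product is needed at several types.\<close>

datatype prod_kind = Cross | Box

primrec tensor :: "prod_kind \<Rightarrow> 'a cspace \<Rightarrow> 'b cspace \<Rightarrow> ('a \<times> 'b) cspace" where
  "tensor Cross = cross_prod"
| "tensor Box = box_prod"

section \<open>Intervals and homotopy\<close>

text \<open>All intervals have points in \<^typ>\<open>real\<close>.\<close>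

definition I_tau :: "real cspace" where
  "I_tau = CSpace {0..1} (\<lambda>A. top_of_set {0..1} closure_of A)"

definition J_top :: "real cspace" where
  "J_top = CSpace {0, 1} (\<lambda>A. if A = {} then {} else {0, 1})"

definition J_plus :: "real cspace" where
  "J_plus = CSpace {0, 1} (\<lambda>A. if 0 \<in> A then {0, 1} else A)"

definition elementary_homotopy ::
  "prod_kind \<Rightarrow> real cspace \<Rightarrow> 'a cspace \<Rightarrow> 'b cspace \<Rightarrow> ('a \<Rightarrow> 'b) \<Rightarrow> ('a \<Rightarrow> 'b) \<Rightarrow> bool" where
  "elementary_homotopy k J X Y f g \<longleftrightarrow>
     ccontinuous X Y f \<and> ccontinuous X Y g \<and>
     (\<exists>H. ccontinuous (tensor k X J) Y H \<and> (\<forall>x \<in> pts X. H (x, 0) = f x \<and> H (x, 1) = g x))"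

definition homotopic ::
  "prod_kind \<Rightarrow> real cspace \<Rightarrow> 'a cspace \<Rightarrow> 'b cspace \<Rightarrow> ('a \<Rightarrow> 'b) \<Rightarrow> ('a \<Rightarrow> 'b) \<Rightarrow> bool" where
  "homotopic k J X Y = equivclp (elementary_homotopy k J X Y)"

section \<open>Singular cubes\<close>

text \<open>Points of the \<open>n\<close>-cube are lists of length \<open>n\<close>; its closure operation is that of the iterated
  product \<open>((J \<otimes> J) \<otimes> \<dots>) \<otimes> J\<close>, transported along appending the last coordinate.\<close>

definition transport :: "('a \<Rightarrow> 'b) \<Rightarrow> 'a cspace \<Rightarrow> 'b cspace" where
  "transport h X = CSpace (h ` pts X) (\<lambda>A. h ` cl X {x \<in> pts X. h x \<in> A})"

primrec cube :: "prod_kind \<Rightarrow> real cspace \<Rightarrow> nat \<Rightarrow> real list cspace" where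
  "cube k J 0 = CSpace {[]} (\<lambda>A. A)"
| "cube k J (Suc n) = transport (\<lambda>(a, t). a @ [t]) (tensor k (cube k J n) J)"

text \<open>Singular cubes are made \<^const>\<open>undefined\<close> off the cube, so that equality of functions is equality
  of maps on the cube.\<close>

definition singular_cubes ::
  "prod_kind \<Rightarrow> real cspace \<Rightarrow> nat \<Rightarrow> 'a cspace \<Rightarrow> (real list \<Rightarrow> 'a) set" where
  "singular_cubes k J n X =
     {\<sigma> \<in> extensional (pts (cube k J n)). ccontinuous (cube k J n) X \<sigma>}"

definition face ::
  "prod_kind \<Rightarrow> real cspace \<Rightarrow> nat \<Rightarrow> nat \<Rightarrow> real \<Rightarrow> (real list \<Rightarrow> 'a) \<Rightarrow> real list \<Rightarrow> 'a" where
  "face k J n i e \<sigma> =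
     restrict (\<lambda>a. \<sigma> (take (i - 1) a @ [e] @ drop (i - 1) a)) (pts (cube k J (n - 1)))"

definition degenerate_cubes ::
  "prod_kind \<Rightarrow> real cspace \<Rightarrow> nat \<Rightarrow> 'a cspace \<Rightarrow> (real list \<Rightarrow> 'a) set" where
  "degenerate_cubes k J n X =
     {\<sigma> \<in> singular_cubes k J n X. \<exists>i \<in> {1..n}. face k J n i 0 \<sigma> = face k J n i 1 \<sigma>}"

section \<open>Chain complex and homology\<close>

type_synonym 'a chain = "(real list \<Rightarrow> 'a) \<Rightarrow>\<^sub>0 int"

abbreviation free_cubes where
  "free_cubes k J n X \<equiv> free_Abelian_group (singular_cubes k J n X)"

abbreviation free_degenerate where
  "free_degenerate k J n X \<equiv> carrier (free_Abelian_group (degenerate_cubes k J n X))"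

text \<open>The map into \<open>G Mod N\<close> that a map \<open>h\<close> into \<open>G\<close> induces on cosets.\<close>

definition coset_map :: "('b, 'm) monoid_scheme \<Rightarrow> 'b set \<Rightarrow> ('a \<Rightarrow> 'b) \<Rightarrow> 'a set \<Rightarrow> 'b set" where
  "coset_map G N h K = the_elem ((\<lambda>a. N #>\<^bsub>G\<^esub> h a) ` K)"

definition chain_group where
  "chain_group k J n X = free_cubes k J n X Mod free_degenerate k J n X"

definition free_boundary ::
  "prod_kind \<Rightarrow> real cspace \<Rightarrow> nat \<Rightarrow> 'a chain \<Rightarrow> 'a chain" where
  "free_boundary k J n = frag_extend (\<lambda>\<sigma>. \<Sum>i = 1..n.
     frag_cmul ((-1) ^ i) (frag_of (face k J n i 0 \<sigma>) - frag_of (face k J n i 1 \<sigma>)))"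

definition boundary ::
  "prod_kind \<Rightarrow> real cspace \<Rightarrow> nat \<Rightarrow> 'a cspace \<Rightarrow>
     'a chain set \<Rightarrow> 'a chain set" where
  "boundary k J n X =
     coset_map (free_cubes k J (n - 1) X) (free_degenerate k J (n - 1) X) (free_boundary k J n)"

text \<open>For \<open>n = 0\<close> the sum in the boundary is empty and \<open>n - 1 = 0\<close>, so the boundary is the zero map of
  the group of 0-chains, with the same kernel as the zero map to the trivial group in degree \<open>-1\<close>.\<close>

definition cycle_group where
  "cycle_group k J n X = (chain_group k J n X)
     \<lparr>carrier := kernel (chain_group k J n X) (chain_group k J (n - 1) X) (boundary k J n X)\<rparr>"

definition boundaries where
  "boundaries k J n X = boundary k J (Suc n) X ` carrier (chain_group k J (Suc n) X)"

definition cubical_homology where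
  "cubical_homology k J n X = cycle_group k J n X Mod boundaries k J n X"

definition free_map ::
  "prod_kind \<Rightarrow> real cspace \<Rightarrow> nat \<Rightarrow> ('a \<Rightarrow> 'b) \<Rightarrow>
     'a chain \<Rightarrow> 'b chain" where
  "free_map k J n f = frag_extend (\<lambda>\<sigma>. frag_of (restrict (f \<circ> \<sigma>) (pts (cube k J n))))"

definition chain_map_induced ::
  "prod_kind \<Rightarrow> real cspace \<Rightarrow> nat \<Rightarrow> 'b cspace \<Rightarrow> ('a \<Rightarrow> 'b) \<Rightarrow>
     'a chain set \<Rightarrow> 'b chain set" where
  "chain_map_induced k J n Y f =
     coset_map (free_cubes k J n Y) (free_degenerate k J n Y) (free_map k J n f)"

text \<open>The domain \<open>X\<close> is not an argument: it only enters through the cosets the map is applied to.\<close>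

definition homology_induced ::
  "prod_kind \<Rightarrow> real cspace \<Rightarrow> nat \<Rightarrow> 'b cspace \<Rightarrow> ('a \<Rightarrow> 'b) \<Rightarrow>
     'a chain set set \<Rightarrow> 'b chain set set" where
  "homology_induced k J n Y f =
     coset_map (cycle_group k J n Y) (boundaries k J n Y) (chain_map_induced k J n Y f)"

end

theory Submission
  imports Defs
begin

text \<open>A homotopy \<open>H\<close> from \<open>f\<close> to \<open>g\<close> turns a singular \<open>n\<close>-cube \<open>\<sigma>\<close> into the \<open>(n + 1)\<close>-cube
  \<open>P \<sigma> (a, t) = H (\<sigma> a, t)\<close>, which is continuous because both products are functorial. The first \<open>n\<close>
  pairs of faces of \<open>P \<sigma>\<close> are the prisms over the faces of \<open>\<sigma>\<close>, the last pair is \<open>f \<circ> \<sigma>\<close> and \<open>g \<circ> \<sigma>\<close>,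
  hence \<open>\<partial> P - P \<partial> = \<plusminus>(f - g)\<close> on free chains. As \<open>P\<close> preserves degenerate cubes, \<open>f\<close> and
  \<open>g\<close> differ by a boundary on every cycle modulo degenerate chains. A zigzag of elementary
  homotopies only needs symmetry and transitivity of equality.\<close>

section \<open>Closure spaces and continuous maps\<close>

lemma closure_space_empty: "closure_space X \<Longrightarrow> cl X {} = {}"
  by (simp add: closure_space_def)

lemma closure_space_extensive: "closure_space X \<Longrightarrow> A \<subseteq> pts X \<Longrightarrow> A \<subseteq> cl X A"
  by (simp add: closure_space_def)

lemma closure_space_cl_subset: "closure_space X \<Longrightarrow> A \<subseteq> pts X \<Longrightarrow> cl X A \<subseteq> pts X"
  by (simp add: closure_space_def)

lemma closure_space_Un:
  "closure_space X \<Longrightarrow> A \<subseteq> pts X \<Longrightarrow> B \<subseteq> pts X \<Longrightarrow> cl X (A \<union> B) = cl X A \<union> cl X B"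
  by (simp add: closure_space_def)

lemma closure_space_mono:
  assumes "closure_space X" "A \<subseteq> B" "B \<subseteq> pts X"
  shows "cl X A \<subseteq> cl X B"
  using closure_space_Un[of X A B] assms by (metis Un_upper1 subset_Un_eq subset_trans)

lemma closure_spaceI:
  assumes "cl X {} = {}"
    and "\<And>A. A \<subseteq> pts X \<Longrightarrow> A \<subseteq> cl X A"
    and "\<And>A. A \<subseteq> pts X \<Longrightarrow> cl X A \<subseteq> pts X"
    and "\<And>A B. A \<subseteq> pts X \<Longrightarrow> B \<subseteq> pts X \<Longrightarrow> cl X (A \<union> B) = cl X A \<union> cl X B"
  shows "closure_space X"
  using assms by (simp add: closure_space_def)

lemma ccontinuousD:
  assumes "ccontinuous X Y f"
  shows "x \<in> pts X \<Longrightarrow> f x \<in> pts Y"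
    and "A \<subseteq> pts X \<Longrightarrow> f ` cl X A \<subseteq> cl Y (f ` A)"
  using assms by (auto simp: ccontinuous_def)

lemma ccontinuous_ident: "ccontinuous X X (\<lambda>x. x)"
  by (simp add: ccontinuous_def)

lemma ccontinuous_compose:
  assumes "ccontinuous X Y f" "ccontinuous Y Z g"
  shows "ccontinuous X Z (g \<circ> f)"
  unfolding ccontinuous_def
proof (intro conjI allI impI)
  show "(g \<circ> f) ` pts X \<subseteq> pts Z"
    using assms by (auto dest: ccontinuousD(1))
next
  fix A assume A: "A \<subseteq> pts X"
  then have "f ` A \<subseteq> pts Y"
    using assms(1) by (auto dest: ccontinuousD(1))
  then show "(g \<circ> f) ` cl X A \<subseteq> cl Z ((g \<circ> f) ` A)"
    using ccontinuousD(2)[OF assms(1) A] ccontinuousD(2)[OF assms(2), of "f ` A"]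
    unfolding image_comp[symmetric] by blast
qed

text \<open>In a closure space closures stay inside \<open>pts X\<close>, so agreement on points
  also gives equal images of closures. This allows passing between a formula and its restriction to
  the cube.\<close>

lemma ccontinuous_cong:
  assumes "closure_space X" "\<And>x. x \<in> pts X \<Longrightarrow> f x = g x"
  shows "ccontinuous X Y f \<longleftrightarrow> ccontinuous X Y g"
proof -
  have "f ` A = g ` A" "f ` cl X A = g ` cl X A" if "A \<subseteq> pts X" for A
    using assms(2) that closure_space_cl_subset[OF assms(1) that] by (auto intro!: image_cong)
  then show ?thesis
    by (simp add: ccontinuous_def)
qed

section \<open>Neighborhoods and their relation to closures\<close>

lemma neighborhood_pts: "closure_space X \<Longrightarrow> x \<in> pts X \<Longrightarrow> neighborhood X x (pts X)"
  by (simp add: neighborhood_def closure_space_empty)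

lemma neighborhood_self: "closure_space X \<Longrightarrow> neighborhood X x U \<Longrightarrow> x \<in> U"
  using closure_space_extensive[of X "pts X - U"] by (auto simp: neighborhood_def)

lemma neighborhood_Int:
  assumes "closure_space X" "neighborhood X x U" "neighborhood X x V"
  shows "neighborhood X x (U \<inter> V)"
proof -
  have "cl X (pts X - U \<inter> V) = cl X (pts X - U) \<union> cl X (pts X - V)"
    using closure_space_Un[OF assms(1), of "pts X - U" "pts X - V"] by (simp add: Diff_Int)
  then show ?thesis
    using assms(2,3) by (auto simp: neighborhood_def)
qed

lemma neighborhood_meets_closure:
  assumes "closure_space X" "neighborhood X x U" "A \<subseteq> pts X" "x \<in> cl X A"
  shows "U \<inter> A \<noteq> {}"
proof
  assume "U \<inter> A = {}"
  then have "A \<subseteq> pts X - U"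
    using assms(3) by auto
  then show False
    using closure_space_mono[OF assms(1), of A "pts X - U"] assms(2,4)
    by (auto simp: neighborhood_def)
qed

text \<open>Links continuity, phrased by closures, with the products, phrased by neighborhoods: if
  \<open>x\<close> were in the closure of the complement of the preimage, \<open>f x\<close> would
  be in the closure of a set missing \<open>V\<close>.\<close>

lemma neighborhood_vimage:
  assumes "closure_space Y" "ccontinuous X Y f" "x \<in> pts X" "neighborhood Y (f x) V"
  shows "neighborhood X x {u \<in> pts X. f u \<in> V}"
proof -
  let ?A = "pts X - {u \<in> pts X. f u \<in> V}"
  have "x \<notin> cl X ?A"
  proof
    assume "x \<in> cl X ?A"
    then have "f x \<in> cl Y (f ` ?A)"
      using ccontinuousD(2)[OF assms(2), of ?A] by auto
    moreover have "f ` ?A \<subseteq> pts Y"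
      using ccontinuousD(1)[OF assms(2)] by auto
    ultimately have "V \<inter> f ` ?A \<noteq> {}"
      using neighborhood_meets_closure[OF assms(1,4)] by blast
    then show False by auto
  qed
  then show ?thesis
    using assms(3) by (auto simp: neighborhood_def)
qed

section \<open>Products\<close>

lemma pts_tensor [simp]: "pts (tensor k X Y) = pts X \<times> pts Y"
  by (cases k) (simp_all add: cross_prod_def box_prod_def)

text \<open>The test set around \<open>(x, y)\<close> is where the two products differ; isolating it
  lets one argument serve both.\<close>

primrec product_neighborhood ::
  "prod_kind \<Rightarrow> 'a \<Rightarrow> 'b \<Rightarrow> 'a set \<Rightarrow> 'b set \<Rightarrow> ('a \<times> 'b) set" where
  "product_neighborhood Cross x y U V = U \<times> V"
| "product_neighborhood Box x y U V = {x} \<times> V \<union> U \<times> {y}"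

lemma cl_tensor_iff:
  "(x, y) \<in> cl (tensor k X Y) A \<longleftrightarrow> x \<in> pts X \<and> y \<in> pts Y \<and>
     (\<forall>U V. neighborhood X x U \<longrightarrow> neighborhood Y y V \<longrightarrow>
        product_neighborhood k x y U V \<inter> A \<noteq> {})"
  by (cases k) (simp_all add: cross_prod_def box_prod_def)

lemma product_neighborhood_mono:
  "U \<subseteq> U' \<Longrightarrow> V \<subseteq> V' \<Longrightarrow> product_neighborhood k x y U V \<subseteq> product_neighborhood k x y U' V'"
  by (cases k) auto

lemma product_neighborhood_self:
  "x \<in> U \<Longrightarrow> y \<in> V \<Longrightarrow> (x, y) \<in> product_neighborhood k x y U V"
  by (cases k) auto

lemma closure_space_tensor:
  assumes X: "closure_space X" and Y: "closure_space Y"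
  shows "closure_space (tensor k X Y)"
proof (rule closure_spaceI)
  let ?T = "tensor k X Y" and ?N = "product_neighborhood k"
  show "cl ?T {} = {}"
    using neighborhood_pts[OF X] neighborhood_pts[OF Y]
    by (auto simp only: cl_tensor_iff equals0D Int_empty_right) blast+
  show "A \<subseteq> cl ?T A" if "A \<subseteq> pts ?T" for A
  proof
    fix p assume p: "p \<in> A"
    obtain x y where xy: "p = (x, y)" by (cases p)
    have "(x, y) \<in> ?N x y U V \<inter> A" if "neighborhood X x U" "neighborhood Y y V" for U V
      using that p xy neighborhood_self[OF X] neighborhood_self[OF Y]
      by (auto intro: product_neighborhood_self)
    then show "p \<in> cl ?T A"
      using that p unfolding xy cl_tensor_iff by auto
  qed
  show "cl ?T A \<subseteq> pts ?T" for A
    by (auto simp: cl_tensor_iff)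
  fix A B
  show "cl ?T (A \<union> B) = cl ?T A \<union> cl ?T B"
  proof
    show "cl ?T A \<union> cl ?T B \<subseteq> cl ?T (A \<union> B)"
      by (auto simp: cl_tensor_iff; blast)
    show "cl ?T (A \<union> B) \<subseteq> cl ?T A \<union> cl ?T B"
    proof
      fix p assume p: "p \<in> cl ?T (A \<union> B)"
      obtain x y where xy: "p = (x, y)" by (cases p)
      show "p \<in> cl ?T A \<union> cl ?T B"
      proof (rule ccontr)
        assume "p \<notin> cl ?T A \<union> cl ?T B"
        then obtain U V U' V' where
          nb: "neighborhood X x U" "neighborhood Y y V" "neighborhood X x U'" "neighborhood Y y V'"
          and dj: "?N x y U V \<inter> A = {}" "?N x y U' V' \<inter> B = {}"
          using p unfolding xy Un_iff cl_tensor_iff by metis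
        \<comment> \<open>Intersecting the neighborhoods gives one test set inside both earlier
          ones; it must meet \<open>A \<union> B\<close>, yet it misses \<open>A\<close> and
          \<open>B\<close>.\<close>
        have "?N x y (U \<inter> U') (V \<inter> V') \<inter> (A \<union> B) \<noteq> {}"
          using p nb unfolding xy cl_tensor_iff by (meson X Y neighborhood_Int)
        then show False
          using dj product_neighborhood_mono[of "U \<inter> U'" U "V \<inter> V'" V k x y]
            product_neighborhood_mono[of "U \<inter> U'" U' "V \<inter> V'" V' k x y] by blast
      qed
    qed
  qed
qed

text \<open>Functoriality of both products: neighborhoods of the image point are pulled back along
  \<open>f\<close> and \<open>g\<close>, and a point of \<open>A\<close> in the resulting test set
  is mapped into the original one.\<close>

lemma ccontinuous_tensor_map_prod:
  assumes X': "closure_space X'" and Y': "closure_space Y'"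
    and f: "ccontinuous X X' f" and g: "ccontinuous Y Y' g"
  shows "ccontinuous (tensor k X Y) (tensor k X' Y') (map_prod f g)"
  unfolding ccontinuous_def
proof (intro conjI allI impI)
  show "map_prod f g ` pts (tensor k X Y) \<subseteq> pts (tensor k X' Y')"
    using f g by (auto dest: ccontinuousD(1))
next
  fix A assume A: "A \<subseteq> pts (tensor k X Y)"
  show "map_prod f g ` cl (tensor k X Y) A \<subseteq> cl (tensor k X' Y') (map_prod f g ` A)"
  proof (intro image_subsetI)
    fix p assume p: "p \<in> cl (tensor k X Y) A"
    obtain x y where xy: "p = (x, y)" by (cases p)
    have pt: "x \<in> pts X" "y \<in> pts Y"
      using p xy by (auto simp: cl_tensor_iff)
    have "product_neighborhood k (f x) (g y) U V \<inter> map_prod f g ` A \<noteq> {}"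
      if "neighborhood X' (f x) U" "neighborhood Y' (g y) V" for U V
    proof -
      have "product_neighborhood k x y {u \<in> pts X. f u \<in> U} {v \<in> pts Y. g v \<in> V} \<inter> A \<noteq> {}"
        using p neighborhood_vimage[OF X' f _ that(1)] neighborhood_vimage[OF Y' g _ that(2)]
        unfolding xy cl_tensor_iff by blast
      then obtain a b where "(a, b) \<in> A"
        "(a, b) \<in> product_neighborhood k x y {u \<in> pts X. f u \<in> U} {v \<in> pts Y. g v \<in> V}"
        by auto
      \<comment> \<open>For \<open>Box\<close>, a point sharing a coordinate with
        \<open>(x, y)\<close> is sent to one sharing that coordinate with
        \<open>(f x, g y)\<close>.\<close>
      moreover from this have "(f a, g b) \<in> product_neighborhood k (f x) (g y) U V"
        by (cases k) auto
      ultimately show ?thesis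
        by force
    qed
    then show "map_prod f g p \<in> cl (tensor k X' Y') (map_prod f g ` A)"
      using pt ccontinuousD(1)[OF f] ccontinuousD(1)[OF g] by (simp add: xy cl_tensor_iff)
  qed
qed

text \<open>As \<open>e\<close> lies in each of its neighborhoods, both kinds of test set contain
  \<open>U \<times> {e}\<close>, which meets the slice over \<open>A\<close>. This will make the
  faces in the last direction continuous.\<close>

lemma ccontinuous_tensor_slice:
  assumes X: "closure_space X" and Y: "closure_space Y" and e: "e \<in> pts Y"
  shows "ccontinuous X (tensor k X Y) (\<lambda>x. (x, e))"
  unfolding ccontinuous_def
proof (intro conjI allI impI)
  show "(\<lambda>x. (x, e)) ` pts X \<subseteq> pts (tensor k X Y)"
    using e by auto
next
  fix A assume A: "A \<subseteq> pts X"
  show "(\<lambda>x. (x, e)) ` cl X A \<subseteq> cl (tensor k X Y) ((\<lambda>x. (x, e)) ` A)"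
  proof (intro image_subsetI)
    fix x assume x: "x \<in> cl X A"
    have "product_neighborhood k x e U V \<inter> (\<lambda>x. (x, e)) ` A \<noteq> {}"
      if "neighborhood X x U" "neighborhood Y e V" for U V
    proof -
      have "U \<inter> A \<noteq> {}"
        using neighborhood_meets_closure[OF X that(1) A x] .
      moreover have "e \<in> V"
        using neighborhood_self[OF Y that(2)] .
      ultimately show ?thesis
        by (cases k) auto
    qed
    then show "(x, e) \<in> cl (tensor k X Y) ((\<lambda>x. (x, e)) ` A)"
      using x e closure_space_cl_subset[OF X A] by (auto simp: cl_tensor_iff)
  qed
qed

section \<open>Intervals\<close>

lemma closure_space_I_tau: "closure_space I_tau"
proof (rule closure_spaceI)
  show "A \<subseteq> cl I_tau A" if "A \<subseteq> pts I_tau" for A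
    using that by (simp add: I_tau_def closure_of_subset)
  show "cl I_tau A \<subseteq> pts I_tau" for A
    using closure_of_subset_topspace[of "top_of_set {0..1}" A] by (simp add: I_tau_def)
qed (simp_all add: I_tau_def closure_of_Un)

lemma closure_space_J_top: "closure_space J_top"
  by (rule closure_spaceI) (auto simp: J_top_def)

lemma closure_space_J_plus: "closure_space J_plus"
  by (rule closure_spaceI) (auto simp: J_plus_def)

section \<open>Cubes\<close>

lemma pts_transport [simp]: "pts (transport h X) = h ` pts X"
  by (simp add: transport_def)

lemma cl_transport: "cl (transport h X) A = h ` cl X {x \<in> pts X. h x \<in> A}"
  by (simp add: transport_def)

lemma closure_space_transport:
  assumes "closure_space X"
  shows "closure_space (transport h X)"
proof (rule closure_spaceI)
  show "cl (transport h X) {} = {}"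
    by (simp add: cl_transport closure_space_empty[OF assms])
  show "A \<subseteq> cl (transport h X) A" if A: "A \<subseteq> pts (transport h X)" for A
    using A closure_space_extensive[OF assms, of "{x \<in> pts X. h x \<in> A}"]
    by (force simp: cl_transport)
  show "cl (transport h X) A \<subseteq> pts (transport h X)" for A
    using closure_space_cl_subset[OF assms, of "{x \<in> pts X. h x \<in> A}"]
    by (auto simp: cl_transport)
  show "cl (transport h X) (A \<union> B) = cl (transport h X) A \<union> cl (transport h X) B" for A B
  proof -
    have "{x \<in> pts X. h x \<in> A \<union> B} = {x \<in> pts X. h x \<in> A} \<union> {x \<in> pts X. h x \<in> B}"
      by auto
    then show ?thesis
      using closure_space_Un[OF assms, of "{x \<in> pts X. h x \<in> A}" "{x \<in> pts X. h x \<in> B}"]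
      by (simp add: cl_transport image_Un)
  qed
qed

lemma ccontinuous_to_transport:
  assumes "closure_space X"
  shows "ccontinuous X (transport h X) h"
  unfolding ccontinuous_def cl_transport
  using closure_space_mono[OF assms, of _ "{x \<in> pts X. h x \<in> h ` A}" for A]
  by (auto intro!: image_mono)

text \<open>Universal property of the transported structure: its closures are images of closures of
  preimages, so a map out of it is tested after composing with \<open>h\<close>.\<close>

lemma ccontinuous_from_transport:
  assumes "ccontinuous X Y (\<phi> \<circ> h)"
  shows "ccontinuous (transport h X) Y \<phi>"
  unfolding ccontinuous_def cl_transport
proof (intro conjI allI impI)
  show "\<phi> ` pts (transport h X) \<subseteq> pts Y"
    using ccontinuousD(1)[OF assms] by auto
next
  fix A assume "A \<subseteq> pts (transport h X)"
  then have "\<phi> ` A = (\<phi> \<circ> h) ` {x \<in> pts X. h x \<in> A}"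
    by auto
  then show "\<phi> ` h ` cl X {x \<in> pts X. h x \<in> A} \<subseteq> cl Y (\<phi> ` A)"
    using ccontinuousD(2)[OF assms, of "{x \<in> pts X. h x \<in> A}"] by (auto simp: image_comp)
qed

text \<open>Collects what the argument uses of the three intervals: the closure axioms, and two end
  points at which faces can be taken.\<close>

locale interval =
  fixes J :: "real cspace" and k :: prod_kind
  assumes closure_space_J: "closure_space J"
    and endpoints: "0 \<in> pts J" "1 \<in> pts J"
begin

text \<open>Forgets the bracketing of the iterated product, so that a coordinate can be inserted
  anywhere in the list.\<close>

lemma pts_cube: "pts (cube k J n) = {a. length a = n \<and> set a \<subseteq> pts J}"
proof (induction n)
  case (Suc n)
  have "(\<lambda>(a, t). a @ [t]) ` ({a. length a = n \<and> set a \<subseteq> pts J} \<times> pts J)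
      = {a. length a = Suc n \<and> set a \<subseteq> pts J}"
  proof (intro equalityI subsetI)
    fix b assume "b \<in> {a. length a = Suc n \<and> set a \<subseteq> pts J}"
    then have "b = butlast b @ [last b]" "length (butlast b) = n" "set b \<subseteq> pts J"
      by (auto intro!: append_butlast_last_id[symmetric])
    then show "b \<in> (\<lambda>(a, t). a @ [t]) ` ({a. length a = n \<and> set a \<subseteq> pts J} \<times> pts J)"
      by (intro image_eqI[of _ _ "(butlast b, last b)"])
        (auto dest: in_set_butlastD simp: subset_iff, metis last_in_set length_0_conv nat.distinct(1) length_append_singleton)
  qed auto
  then show ?case
    using Suc by simp
qed auto

lemma closure_space_cube: "closure_space (cube k J n)"
proof (induction n)
  case 0
  then show ?case
    by (simp add: closure_space_def)
next
  case (Suc n)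
  then show ?case
    by (simp add: closure_space_transport closure_space_tensor closure_space_J)
qed

lemma ccontinuous_snoc:
  "ccontinuous (tensor k (cube k J n) J) (cube k J (Suc n)) (\<lambda>(a, t). a @ [t])"
  using ccontinuous_to_transport[OF closure_space_tensor[OF closure_space_cube closure_space_J]]
  by simp

text \<open>The inclusion of a face into the cube; \<open>face\<close> is precomposition with it.
  Positions count from 1, hence \<open>i - 1\<close> coordinates stay in front.\<close>

definition insert_coord :: "nat \<Rightarrow> real \<Rightarrow> real list \<Rightarrow> real list" where
  "insert_coord i e a = take (i - 1) a @ [e] @ drop (i - 1) a"

lemma insert_coord_snoc:
  "i \<le> Suc (length a) \<Longrightarrow> insert_coord i e (a @ [t]) = insert_coord i e a @ [t]"
  by (cases i) (auto simp: insert_coord_def)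

lemma ccontinuous_insert_coord_last:
  assumes "e \<in> pts J"
  shows "ccontinuous (cube k J n) (cube k J (Suc n)) (insert_coord (Suc n) e)"
proof -
  have "ccontinuous (cube k J n) (cube k J (Suc n)) ((\<lambda>(a, t). a @ [t]) \<circ> (\<lambda>a. (a, e)))"
    by (rule ccontinuous_compose[OF ccontinuous_tensor_slice ccontinuous_snoc])
      (use assms closure_space_cube closure_space_J in auto)
  then show ?thesis
    by (subst ccontinuous_cong[OF closure_space_cube, of _ _ "(\<lambda>(a, t). a @ [t]) \<circ> (\<lambda>a. (a, e))"])
      (auto simp: pts_cube insert_coord_def)
qed

text \<open>The product is bracketed to the left, so only the last coordinate is directly
  accessible. Insertion further left acts on the left factor and commutes with appending, which
  gives the induction; insertion at the end is a slice.\<close>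

lemma ccontinuous_insert_coord:
  assumes "e \<in> pts J" "1 \<le> i" "i \<le> Suc n"
  shows "ccontinuous (cube k J n) (cube k J (Suc n)) (insert_coord i e)"
  using assms(2,3)
proof (induction n)
  case 0
  then show ?case
    using ccontinuous_insert_coord_last[OF assms(1), of 0] 0 by (simp del: cube.simps)
next
  case (Suc n)
  show ?case
  proof (cases "i \<le> Suc n")
    case True
    have "ccontinuous (tensor k (cube k J n) J) (cube k J (Suc (Suc n)))
        ((\<lambda>(a, t). a @ [t]) \<circ> map_prod (insert_coord i e) (\<lambda>t. t))"
      by (intro ccontinuous_compose[OF ccontinuous_tensor_map_prod ccontinuous_snoc]
          closure_space_cube closure_space_J ccontinuous_ident Suc.IH Suc.prems True)
    moreover have "((\<lambda>(a, t). a @ [t]) \<circ> map_prod (insert_coord i e) (\<lambda>t. t)) p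
        = (insert_coord i e \<circ> (\<lambda>(a, t). a @ [t])) p" if "p \<in> pts (tensor k (cube k J n) J)" for p
      using that True by (auto simp: pts_cube insert_coord_snoc)
    ultimately have "ccontinuous (tensor k (cube k J n) J) (cube k J (Suc (Suc n)))
        (insert_coord i e \<circ> (\<lambda>(a, t). a @ [t]))"
      using ccontinuous_cong[OF closure_space_tensor[OF closure_space_cube closure_space_J]] by blast
    \<comment> \<open>The larger domain cube is by definition transported along appending, so
      continuity need only hold after appending.\<close>
    from ccontinuous_from_transport[OF this] show ?thesis
      by simp
  next
    case False
    then have "i = Suc (Suc n)"
      using Suc.prems by simp
    then show ?thesis
      using ccontinuous_insert_coord_last[OF assms(1)] by (simp del: cube.simps)
  qed
qed

section \<open>Faces and prisms\<close>

lemma insert_coord_append: "insert_coord (Suc (length u)) e (u @ v) = u @ e # v"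
  by (simp add: insert_coord_def)

text \<open>Both sides are \<open>u @ e # v @ e' # w\<close>: inserting \<open>e\<close> first
  shifts the later position up by one.\<close>

lemma insert_coord_commute:
  assumes "1 \<le> i" "i < j" "j \<le> length a + 2"
  shows "insert_coord j e' (insert_coord i e a) = insert_coord i e (insert_coord (j - 1) e' a)"
proof -
  \<comment> \<open>The blocks of \<open>a\<close> before, between and after the two inserted
    entries.\<close>
  define u v w where "u = take (i - 1) a" and "v = take (j - 1 - i) (drop (i - 1) a)"
    and "w = drop (j - 2) a"
  have a: "a = u @ v @ w"
    using assms append_take_drop_id[of "j - 1 - i" "drop (i - 1) a"]
    by (simp add: u_def v_def w_def numeral_2_eq_2)
  have i: "i = Suc (length u)" and j: "j = Suc (Suc (length u + length v))"
    using assms by (auto simp: u_def v_def)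
  show ?thesis
    using insert_coord_append[of "u @ e # v" e' w] insert_coord_append[of u e "v @ e' # w"]
      insert_coord_append[of u e "v @ w"] insert_coord_append[of "u @ v" e' w]
    by (simp add: a i j)
qed

lemma insert_coord_in_cube:
  "a \<in> pts (cube k J n) \<Longrightarrow> e \<in> pts J \<Longrightarrow> insert_coord i e a \<in> pts (cube k J (Suc n))"
  by (auto simp: pts_cube insert_coord_def simp del: cube.simps
      dest: in_set_takeD in_set_dropD)

lemma face_Suc: "face k J (Suc n) i e \<sigma> = restrict (\<sigma> \<circ> insert_coord i e) (pts (cube k J n))"
  by (simp add: face_def insert_coord_def comp_def)

lemma face_apply: "a \<in> pts (cube k J n) \<Longrightarrow> face k J (Suc n) i e \<sigma> a = \<sigma> (insert_coord i e a)"
  by (simp add: face_Suc)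

lemma singular_cubesI:
  assumes "ccontinuous (cube k J n) X \<sigma>"
  shows "restrict \<sigma> (pts (cube k J n)) \<in> singular_cubes k J n X"
  using assms ccontinuous_cong[OF closure_space_cube, of n "restrict \<sigma> (pts (cube k J n))" \<sigma> X]
  by (simp add: singular_cubes_def)

lemma singular_cubesD: "\<sigma> \<in> singular_cubes k J n X \<Longrightarrow> ccontinuous (cube k J n) X \<sigma>"
  by (simp add: singular_cubes_def)

lemma face_singular:
  assumes "\<sigma> \<in> singular_cubes k J (Suc n) X" "e \<in> pts J" "i \<in> {1..Suc n}"
  shows "face k J (Suc n) i e \<sigma> \<in> singular_cubes k J n X"
  unfolding face_Suc
  by (rule singular_cubesI[OF ccontinuous_compose[OF ccontinuous_insert_coord singular_cubesD]])
    (use assms in auto)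

text \<open>The cubical identity dual to \<open>insert_coord_commute\<close>. Membership of
  \<open>e\<close> and \<open>e'\<close> in \<open>J\<close> keeps the lists inside the cubes to
  which the faces are restricted.\<close>

lemma face_face:
  assumes "1 \<le> i" "i < j" "j \<le> Suc (Suc n)" "e \<in> pts J" "e' \<in> pts J"
  shows "face k J (Suc n) i e (face k J (Suc (Suc n)) j e' \<sigma>)
       = face k J (Suc n) (j - 1) e' (face k J (Suc (Suc n)) i e \<sigma>)"
  unfolding face_Suc[of n]
proof (rule restrict_ext)
  fix a assume a: "a \<in> pts (cube k J n)"
  then have "length a = n"
    by (simp add: pts_cube)
  then show "(face k J (Suc (Suc n)) j e' \<sigma> \<circ> insert_coord i e) a
      = (face k J (Suc (Suc n)) i e \<sigma> \<circ> insert_coord (j - 1) e') a"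
    using assms a insert_coord_commute[of i j a e' e]
    by (simp add: face_apply insert_coord_in_cube del: cube.simps)
qed

lemma degenerate_subset_singular: "degenerate_cubes k J n X \<subseteq> singular_cubes k J n X"
  by (auto simp: degenerate_cubes_def)

text \<open>Faces in different directions commute, so the equality of the two \<open>j\<close>-faces
  survives in every face with \<open>i \<noteq> j\<close>.\<close>

lemma face_degenerate:
  assumes \<sigma>: "\<sigma> \<in> singular_cubes k J (Suc n) X"
    and ij: "i \<in> {1..Suc n}" "j \<in> {1..Suc n}" "i \<noteq> j"
    and eq: "face k J (Suc n) j 0 \<sigma> = face k J (Suc n) j 1 \<sigma>" and e: "e \<in> pts J"
  shows "face k J (Suc n) i e \<sigma> \<in> degenerate_cubes k J n X"
proof -
  obtain m where n: "n = Suc m"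
    using ij by (cases n) auto
  \<comment> \<open>The index of direction \<open>j\<close> once coordinate \<open>i\<close> has
    been removed.\<close>
  define l where "l = (if i < j then j - 1 else j)"
  have l: "l \<in> {1..n}"
    using ij by (auto simp: l_def n)
  have "face k J n l 0 (face k J (Suc n) i e \<sigma>) = face k J n l 1 (face k J (Suc n) i e \<sigma>)"
  proof (cases "i < j")
    case True
    then show ?thesis
      using face_face[of i j m e 0 \<sigma>] face_face[of i j m e 1 \<sigma>] ij e endpoints eq
      by (simp add: n l_def)
  next
    case False
    then show ?thesis
      using face_face[of j i m 0 e \<sigma>] face_face[of j i m 1 e \<sigma>] ij e endpoints eq
      by (simp add: n l_def)
  qed
  then show ?thesis
    using face_singular[OF \<sigma> e ij(1)] l unfolding degenerate_cubes_def by blast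
qed

lemma face_map:
  assumes "e \<in> pts J"
  shows "face k J (Suc n) i e (restrict (f \<circ> \<sigma>) (pts (cube k J (Suc n))))
       = restrict (f \<circ> face k J (Suc n) i e \<sigma>) (pts (cube k J n))"
  using assms
  by (auto simp: fun_eq_iff face_Suc restrict_def insert_coord_in_cube simp del: cube.simps)

lemma map_singular:
  assumes "ccontinuous X Y f" "\<sigma> \<in> singular_cubes k J n X"
  shows "restrict (f \<circ> \<sigma>) (pts (cube k J n)) \<in> singular_cubes k J n Y"
  by (intro singular_cubesI ccontinuous_compose[OF singular_cubesD assms(1)] assms(2))

lemma map_degenerate:
  assumes f: "ccontinuous X Y f" and \<sigma>: "\<sigma> \<in> degenerate_cubes k J n X"
  shows "restrict (f \<circ> \<sigma>) (pts (cube k J n)) \<in> degenerate_cubes k J n Y"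
proof -
  obtain i where i: "i \<in> {1..n}" "face k J n i 0 \<sigma> = face k J n i 1 \<sigma>"
    using \<sigma> by (auto simp: degenerate_cubes_def)
  then obtain m where n: "n = Suc m"
    by (cases n) auto
  have "face k J n i 0 (restrict (f \<circ> \<sigma>) (pts (cube k J n)))
      = face k J n i 1 (restrict (f \<circ> \<sigma>) (pts (cube k J n)))"
    using i(2) endpoints by (simp add: n face_map del: cube.simps)
  then show ?thesis
    using i(1) map_singular[OF f, of \<sigma> n] \<sigma> by (auto simp: degenerate_cubes_def)
qed

section \<open>Prisms: the homotopy parameter becomes the last coordinate\<close>

definition prism :: "('a \<times> real \<Rightarrow> 'b) \<Rightarrow> nat \<Rightarrow> (real list \<Rightarrow> 'a) \<Rightarrow> real list \<Rightarrow> 'b" where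
  "prism H n \<sigma> = restrict (\<lambda>b. H (\<sigma> (butlast b), last b)) (pts (cube k J (Suc n)))"

text \<open>The prism is \<open>H\<close> after \<open>\<sigma>\<close> times the identity of
  \<open>J\<close>, read on lists; functoriality of the product and the universal property of
  \<open>transport\<close> give continuity.\<close>

lemma prism_singular:
  assumes X: "closure_space X" and H: "ccontinuous (tensor k X J) Y H"
    and \<sigma>: "\<sigma> \<in> singular_cubes k J n X"
  shows "prism H n \<sigma> \<in> singular_cubes k J (Suc n) Y"
proof -
  have "ccontinuous (tensor k (cube k J n) J) Y (H \<circ> map_prod \<sigma> (\<lambda>t. t))"
    by (rule ccontinuous_compose[OF ccontinuous_tensor_map_prod[OF X closure_space_J
            singular_cubesD[OF \<sigma>] ccontinuous_ident] H])
  moreover have "H \<circ> map_prod \<sigma> (\<lambda>t. t)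
      = (\<lambda>b. H (\<sigma> (butlast b), last b)) \<circ> (\<lambda>(a, t). a @ [t])"
    by auto
  ultimately have "ccontinuous (cube k J (Suc n)) Y (\<lambda>b. H (\<sigma> (butlast b), last b))"
    using ccontinuous_from_transport by fastforce
  then show ?thesis
    unfolding prism_def by (rule singular_cubesI)
qed

text \<open>Since the homotopy parameter comes last, inserting a coordinate before it keeps the
  index \<open>i\<close>, and no sign will appear in the boundary formula.\<close>

lemma face_prism:
  assumes "i \<in> {1..Suc n}" "e \<in> pts J"
  shows "face k J (Suc (Suc n)) i e (prism H (Suc n) \<sigma>) = prism H n (face k J (Suc n) i e \<sigma>)"
  unfolding face_Suc[of "Suc n"] prism_def[of H n]
proof (rule restrict_ext)
  fix b assume b: "b \<in> pts (cube k J (Suc n))"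
  then have len: "length b = Suc n" and "set b \<subseteq> pts J"
    by (auto simp: pts_cube simp del: cube.simps)
  define a t where "a = butlast b" and "t = last b"
  have ab: "b = a @ [t]"
    using len by (auto simp: a_def t_def intro!: append_butlast_last_id[symmetric])
  have a: "a \<in> pts (cube k J n)" and la: "length a = n"
    using len \<open>set b \<subseteq> pts J\<close> by (auto simp: ab pts_cube)
  show "(prism H (Suc n) \<sigma> \<circ> insert_coord i e) b
      = H (face k J (Suc n) i e \<sigma> (butlast b), last b)"
    using insert_coord_in_cube[OF b assms(2), of i] assms(1) a la
    by (simp add: prism_def ab insert_coord_snoc face_apply del: cube.simps)
qed

lemma face_prism_last:
  assumes "e \<in> pts J"
  shows "face k J (Suc n) (Suc n) e (prism H n \<sigma>) = restrict (\<lambda>a. H (\<sigma> a, e)) (pts (cube k J n))"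
  unfolding face_Suc
proof (rule restrict_ext)
  fix a assume a: "a \<in> pts (cube k J n)"
  then have "insert_coord (Suc n) e a = a @ [e]"
    by (auto simp: pts_cube insert_coord_def)
  then show "(prism H n \<sigma> \<circ> insert_coord (Suc n) e) a = H (\<sigma> a, e)"
    using insert_coord_in_cube[OF a assms, of "Suc n"] by (simp add: prism_def del: cube.simps)
qed

text \<open>By \<open>face_prism\<close> the direction of degeneracy of \<open>\<sigma>\<close> also
  serves for its prism.\<close>

lemma prism_degenerate:
  assumes X: "closure_space X" and H: "ccontinuous (tensor k X J) Y H"
    and \<sigma>: "\<sigma> \<in> degenerate_cubes k J n X"
  shows "prism H n \<sigma> \<in> degenerate_cubes k J (Suc n) Y"
proof -
  obtain i where i: "i \<in> {1..n}" "face k J n i 0 \<sigma> = face k J n i 1 \<sigma>"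
    using \<sigma> by (auto simp: degenerate_cubes_def)
  then obtain m where n: "n = Suc m"
    by (cases n) auto
  have "face k J (Suc n) i 0 (prism H n \<sigma>) = face k J (Suc n) i 1 (prism H n \<sigma>)"
    using i face_prism[of i m _ H \<sigma>] endpoints by (simp add: n)
  then show ?thesis
    using i(1) prism_singular[OF X H, of \<sigma> n] \<sigma> by (auto simp: degenerate_cubes_def)
qed

section \<open>Free chains\<close>

lemma keys_frag_extend_subset:
  assumes "Poly_Mapping.keys c \<subseteq> S" "\<And>x. x \<in> S \<Longrightarrow> Poly_Mapping.keys (\<phi> x) \<subseteq> T"
  shows "Poly_Mapping.keys (frag_extend \<phi> c) \<subseteq> T"
  using keys_frag_extend[of \<phi> c] assms by blast

text \<open>In each direction the two faces either cancel or both lie in \<open>S\<close>. The first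
  alternative is what degenerate cubes require in their degenerate direction.\<close>

lemma keys_boundary_sum_subset:
  assumes "\<And>i. i \<in> {1..n} \<Longrightarrow> face k J n i 0 \<sigma> = face k J n i 1 \<sigma> \<or>
     face k J n i 0 \<sigma> \<in> S \<and> face k J n i 1 \<sigma> \<in> S"
  shows "Poly_Mapping.keys (\<Sum>i = 1..n. frag_cmul ((-1) ^ i)
     (frag_of (face k J n i 0 \<sigma>) - frag_of (face k J n i 1 \<sigma>))) \<subseteq> S"
proof -
  have "Poly_Mapping.keys (frag_cmul ((-1) ^ i)
     (frag_of (face k J n i 0 \<sigma>) - frag_of (face k J n i 1 \<sigma>))) \<subseteq> S" if "i \<in> {1..n}" for i
  proof -
    have "Poly_Mapping.keys (frag_of (face k J n i 0 \<sigma>) - frag_of (face k J n i 1 \<sigma>)) \<subseteq> S"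
      using assms[OF that] keys_diff[of "frag_of (face k J n i 0 \<sigma>)" "frag_of (face k J n i 1 \<sigma>)"]
      by auto
    then show ?thesis
      by (meson keys_cmul subset_trans)
  qed
  then show ?thesis
    by (intro order_trans[OF keys_sum]) blast
qed

lemma free_boundary_0: "free_boundary k J 0 c = 0"
  by (simp add: free_boundary_def frag_extend_eq_0)

lemma free_boundary_singular:
  assumes "Poly_Mapping.keys c \<subseteq> singular_cubes k J n X"
  shows "Poly_Mapping.keys (free_boundary k J n c) \<subseteq> singular_cubes k J (n - 1) X"
proof (cases n)
  case (Suc m)
  show ?thesis
    unfolding free_boundary_def
    by (rule keys_frag_extend_subset[OF assms], rule keys_boundary_sum_subset)
      (use Suc endpoints in \<open>auto intro: face_singular\<close>)
qed (simp add: free_boundary_0)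

lemma free_boundary_degenerate:
  assumes "Poly_Mapping.keys c \<subseteq> degenerate_cubes k J n X"
  shows "Poly_Mapping.keys (free_boundary k J n c) \<subseteq> degenerate_cubes k J (n - 1) X"
proof (cases n)
  case (Suc m)
  show ?thesis
    unfolding free_boundary_def
  proof (rule keys_frag_extend_subset[OF assms], rule keys_boundary_sum_subset)
    fix \<sigma> i assume \<sigma>: "\<sigma> \<in> degenerate_cubes k J n X" and i: "i \<in> {1..n}"
    obtain j where j: "j \<in> {1..n}" "face k J n j 0 \<sigma> = face k J n j 1 \<sigma>"
      using \<sigma> by (auto simp: degenerate_cubes_def)
    then show "face k J n i 0 \<sigma> = face k J n i 1 \<sigma> \<or>
        face k J n i 0 \<sigma> \<in> degenerate_cubes k J (n - 1) X \<and>
        face k J n i 1 \<sigma> \<in> degenerate_cubes k J (n - 1) X"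
      using face_degenerate[of \<sigma> m X i j] i \<sigma> degenerate_subset_singular[of n X] endpoints
      unfolding Suc by auto
  qed
qed (simp add: free_boundary_0)

lemma free_map_singular:
  assumes "ccontinuous X Y f" "Poly_Mapping.keys c \<subseteq> singular_cubes k J n X"
  shows "Poly_Mapping.keys (free_map k J n f c) \<subseteq> singular_cubes k J n Y"
  unfolding free_map_def
  by (rule keys_frag_extend_subset[OF assms(2)]) (simp add: map_singular[OF assms(1)])

lemma free_map_degenerate:
  assumes "ccontinuous X Y f" "Poly_Mapping.keys c \<subseteq> degenerate_cubes k J n X"
  shows "Poly_Mapping.keys (free_map k J n f c) \<subseteq> degenerate_cubes k J n Y"
  unfolding free_map_def
  by (rule keys_frag_extend_subset[OF assms(2)]) (simp add: map_degenerate[OF assms(1)])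

lemmas frag_extend_linear =
  frag_extend_sum frag_extend_cmul frag_extend_diff frag_extend_add o_def

lemma free_boundary_free_map:
  "free_boundary k J n (free_map k J n f c) = free_map k J (n - 1) f (free_boundary k J n c)"
proof (cases n)
  case 0
  then show ?thesis
    by (simp add: free_boundary_0 free_map_def)
next
  case (Suc m)
  show ?thesis
    \<comment> \<open>Commutation with faces holds for arbitrary functions, so the induction runs
      over all generators rather than over singular cubes.\<close>
    using subset_UNIV[of "Poly_Mapping.keys c"]
  proof (induction c rule: frag_induction)
    case (one \<sigma>)
    then show ?case
      using endpoints
      by (simp add: Suc free_boundary_def free_map_def frag_extend_linear
          face_map[unfolded o_def] del: cube.simps sum.cl_ivl_Suc)
  qed (simp_all add: free_boundary_def free_map_def frag_extend_diff)
qed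

lemma frag_cmul_diff: "frag_cmul m (a - b) = frag_cmul m a - frag_cmul m b"
  using frag_cmul_distrib2[of m "a - b" b] by simp

section \<open>The prism operator on free chains\<close>

definition free_prism :: "('a \<times> real \<Rightarrow> 'b) \<Rightarrow> nat \<Rightarrow> 'a chain \<Rightarrow> 'b chain" where
  "free_prism H n = frag_extend (\<lambda>\<sigma>. frag_of (prism H n \<sigma>))"

lemma free_prism_singular:
  assumes "closure_space X" "ccontinuous (tensor k X J) Y H"
    and "Poly_Mapping.keys c \<subseteq> singular_cubes k J n X"
  shows "Poly_Mapping.keys (free_prism H n c) \<subseteq> singular_cubes k J (Suc n) Y"
  unfolding free_prism_def
  by (rule keys_frag_extend_subset[OF assms(3)]) (simp add: prism_singular[OF assms(1,2)])

lemma free_prism_degenerate: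
  assumes "closure_space X" "ccontinuous (tensor k X J) Y H"
    and "Poly_Mapping.keys c \<subseteq> degenerate_cubes k J n X"
  shows "Poly_Mapping.keys (free_prism H n c) \<subseteq> degenerate_cubes k J (Suc n) Y"
  unfolding free_prism_def
  by (rule keys_frag_extend_subset[OF assms(3)]) (simp add: prism_degenerate[OF assms(1,2)])

text \<open>On a generator the first \<open>n\<close> directions give the prism of the boundary, and
  direction \<open>n + 1\<close> contributes \<open>f\<close> minus \<open>g\<close> with sign
  \<open>(-1) ^ Suc n\<close>. For \<open>n = 0\<close> the prism of the boundary is zero.\<close>

lemma free_boundary_free_prism:
  assumes "\<And>x. x \<in> pts X \<Longrightarrow> H (x, 0) = f x" "\<And>x. x \<in> pts X \<Longrightarrow> H (x, 1) = g x"
    and "Poly_Mapping.keys c \<subseteq> singular_cubes k J n X"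
  shows "free_boundary k J (Suc n) (free_prism H n c)
    = free_prism H (n - 1) (free_boundary k J n c)
      + frag_cmul ((-1) ^ Suc n) (free_map k J n f c - free_map k J n g c)"
  using assms(3)
proof (induction c rule: frag_induction)
  case (one \<sigma>)
  \<comment> \<open>Continuity of \<open>\<sigma>\<close> puts its values in \<open>pts X\<close>,
    where \<open>H\<close> is known at both ends.\<close>
  have last: "face k J (Suc n) (Suc n) 0 (prism H n \<sigma>) = restrict (f \<circ> \<sigma>) (pts (cube k J n))"
    "face k J (Suc n) (Suc n) 1 (prism H n \<sigma>) = restrict (g \<circ> \<sigma>) (pts (cube k J n))"
    using assms(1,2) ccontinuousD(1)[OF singular_cubesD[OF one]] endpoints
    by (auto simp: face_prism_last restrict_def fun_eq_iff)
  have init: "face k J (Suc n) i e (prism H n \<sigma>) = prism H (n - 1) (face k J n i e \<sigma>)"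
    if "i \<in> {1..n}" "e \<in> {0, 1}" for i e
    using face_prism[of i "n - 1" e H \<sigma>] that endpoints by (cases n) auto
  show ?case
    using last init
    by (simp add: free_boundary_def free_prism_def free_map_def frag_extend_linear)
next
  case (diff a b)
  have "free_boundary k J (Suc n) (free_prism H n (a - b))
      = free_boundary k J (Suc n) (free_prism H n a) - free_boundary k J (Suc n) (free_prism H n b)"
    "free_prism H (n - 1) (free_boundary k J n (a - b))
      = free_prism H (n - 1) (free_boundary k J n a) - free_prism H (n - 1) (free_boundary k J n b)"
    "frag_cmul ((-1) ^ Suc n) (free_map k J n f (a - b) - free_map k J n g (a - b))
      = frag_cmul ((-1) ^ Suc n) (free_map k J n f a - free_map k J n g a)
      - frag_cmul ((-1) ^ Suc n) (free_map k J n f b - free_map k J n g b)"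
    by (simp_all add: free_boundary_def free_prism_def free_map_def frag_extend_diff frag_cmul_diff)
  then show ?case
    using diff by simp
qed (simp add: free_boundary_def free_prism_def free_map_def)

text \<open>The prism formula solved for the image under \<open>f\<close>. A cycle modulo
  degenerates has degenerate boundary, whose prism is the degenerate error term
  \<open>d\<close>.\<close>

lemma free_map_homotopic_cycle:
  assumes X: "closure_space X" and H: "ccontinuous (tensor k X J) Y H"
    and "\<And>x. x \<in> pts X \<Longrightarrow> H (x, 0) = f x" "\<And>x. x \<in> pts X \<Longrightarrow> H (x, 1) = g x"
    and c: "Poly_Mapping.keys c \<subseteq> singular_cubes k J n X"
    and cycle: "Poly_Mapping.keys (free_boundary k J n c) \<subseteq> degenerate_cubes k J (n - 1) X"
  obtains b d where "Poly_Mapping.keys b \<subseteq> singular_cubes k J (Suc n) Y"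
    and "Poly_Mapping.keys d \<subseteq> degenerate_cubes k J n Y"
    and "free_map k J n f c = free_boundary k J (Suc n) b + d + free_map k J n g c"
proof
  \<comment> \<open>The factor squares the sign in the prism formula to 1; the term left over then
    carries the opposite sign \<open>(-1) ^ n\<close>.\<close>
  let ?b = "frag_cmul ((-1) ^ Suc n) (free_prism H n c)"
  let ?d = "frag_cmul ((-1) ^ n) (free_prism H (n - 1) (free_boundary k J n c))"
  show "Poly_Mapping.keys ?b \<subseteq> singular_cubes k J (Suc n) Y"
    using free_prism_singular[OF X H c] keys_cmul by (meson subset_trans)
  show "Poly_Mapping.keys ?d \<subseteq> degenerate_cubes k J n Y"
  \<comment> \<open>Only for positive \<open>n\<close> does the prism operator of index
    \<open>n - 1\<close> land in degree \<open>n\<close>; for \<open>n = 0\<close> the boundary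
    vanishes.\<close>
  proof (cases n)
    case 0
    then show ?thesis
      by (simp add: free_boundary_0 free_prism_def)
  next
    case (Suc m)
    then show ?thesis
      using free_prism_degenerate[OF X H cycle] by (intro order_trans[OF keys_cmul]) simp
  qed
  have "free_boundary k J (Suc n) ?b
      = frag_cmul ((-1) ^ Suc n) (free_boundary k J (Suc n) (free_prism H n c))"
    by (simp only: free_boundary_def frag_extend_cmul)
  also have "\<dots> = free_map k J n f c - free_map k J n g c - ?d"
    using free_boundary_free_prism[OF assms(3,4) c]
    by (simp add: frag_cmul_distrib2 flip: power_mult_distrib)
  finally show "free_map k J n f c = free_boundary k J (Suc n) ?b + ?d + free_map k J n g c"
    by simp
qed

end

section \<open>Maps of quotient groups\<close>

text \<open>Members of one coset differ by some \<open>m\<close> in \<open>M\<close>, and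
  \<open>h m\<close> lies in \<open>N\<close>, so all of them yield the same coset of
  \<open>N\<close>.\<close>

lemma coset_map_r_coset:
  assumes "group G" "group G'" and M: "subgroup M G" and N: "subgroup N G'"
    and h: "h \<in> hom G G'" and hM: "h ` M \<subseteq> N" and c: "c \<in> carrier G"
  shows "coset_map G' N h (M #>\<^bsub>G\<^esub> c) = N #>\<^bsub>G'\<^esub> h c"
proof -
  interpret G: group G by fact
  interpret G': group G' by fact
  interpret M: subgroup M G by fact
  interpret N: subgroup N G' by fact
  have "N #>\<^bsub>G'\<^esub> h (m \<otimes>\<^bsub>G\<^esub> c) = N #>\<^bsub>G'\<^esub> h c" if m: "m \<in> M" for m
  proof -
    have "h m \<in> N" "h c \<in> carrier G'" "h (m \<otimes>\<^bsub>G\<^esub> c) = h m \<otimes>\<^bsub>G'\<^esub> h c"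
      using hM m c h by (auto simp: hom_def)
    then show ?thesis
      using G'.coset_mult_assoc[OF N.subset, of "h m" "h c"] G'.coset_join2[OF _ N, of "h m"]
      by auto
  qed
  then have "N #>\<^bsub>G'\<^esub> h a = N #>\<^bsub>G'\<^esub> h c" if "a \<in> M #>\<^bsub>G\<^esub> c" for a
    using that unfolding r_coset_def by blast
  \<comment> \<open>Nonemptiness makes the image a singleton, as \<open>the_elem\<close>
    requires.\<close>
  moreover have "M #>\<^bsub>G\<^esub> c \<noteq> {}"
    using M.one_closed unfolding r_coset_def by blast
  ultimately have "(\<lambda>a. N #>\<^bsub>G'\<^esub> h a) ` (M #>\<^bsub>G\<^esub> c) = {N #>\<^bsub>G'\<^esub> h c}"
    by (simp add: image_constant_conv cong: image_cong_simp)
  then show ?thesis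
    by (simp add: coset_map_def)
qed

lemma coset_map_hom:
  assumes M: "M \<lhd> G" and N: "N \<lhd> G'" and h: "h \<in> hom G G'" and hM: "h ` M \<subseteq> N"
  shows "coset_map G' N h \<in> hom (G Mod M) (G' Mod N)"
proof -
  interpret M: normal M G by fact
  interpret N: normal N G' by fact
  note cm = coset_map_r_coset[OF M.is_group N.is_group M.subgroup_axioms N.subgroup_axioms h hM]
  show ?thesis
  proof (rule homI)
    fix K assume "K \<in> carrier (G Mod M)"
    then show "coset_map G' N h K \<in> carrier (G' Mod N)"
      using h by (auto simp: FactGroup_def RCOSETS_def cm hom_def)
  next
    fix K L assume "K \<in> carrier (G Mod M)" "L \<in> carrier (G Mod M)"
    then obtain a b where "a \<in> carrier G" "b \<in> carrier G" "K = M #>\<^bsub>G\<^esub> a" "L = M #>\<^bsub>G\<^esub> b"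
      by (auto simp: FactGroup_def RCOSETS_def)
    moreover from this have "h a \<in> carrier G'" "h b \<in> carrier G'"
      "h (a \<otimes>\<^bsub>G\<^esub> b) = h a \<otimes>\<^bsub>G'\<^esub> h b"
      using h by (auto simp: hom_def)
    ultimately show "coset_map G' N h (K \<otimes>\<^bsub>G Mod M\<^esub> L)
        = coset_map G' N h K \<otimes>\<^bsub>G' Mod N\<^esub> coset_map G' N h L"
      by (simp add: FactGroup_def M.rcos_sum N.rcos_sum cm)
  qed
qed

lemma subgroup_free_Abelian_group:
  assumes "S \<subseteq> T"
  shows "subgroup (carrier (free_Abelian_group S)) (free_Abelian_group T)"
proof
  fix x y assume "x \<in> carrier (free_Abelian_group S)" "y \<in> carrier (free_Abelian_group S)"
  then show "x \<otimes>\<^bsub>free_Abelian_group T\<^esub> y \<in> carrier (free_Abelian_group S)"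
    using keys_add[of x y] by auto
qed (use assms in auto)

section \<open>Chain groups\<close>

abbreviation chain_class where
  "chain_class k J n X c \<equiv> free_degenerate k J n X #>\<^bsub>free_cubes k J n X\<^esub> c"

context interval
begin

lemma normal_free_degenerate: "free_degenerate k J n X \<lhd> free_cubes k J n X"
  by (intro comm_group.subgroup_imp_normal abelian_free_Abelian_group subgroup_free_Abelian_group
      degenerate_subset_singular)

lemma group_chain_group: "group (chain_group k J n X)"
  unfolding chain_group_def by (rule normal.factorgroup_is_group[OF normal_free_degenerate])

lemma carrier_chain_group:
  "carrier (chain_group k J n X) = chain_class k J n X ` carrier (free_cubes k J n X)"
  by (auto simp: chain_group_def FactGroup_def RCOSETS_def)

lemma chain_class_add:
  assumes "a \<in> carrier (free_cubes k J n X)" "b \<in> carrier (free_cubes k J n X)"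
  shows "chain_class k J n X a \<otimes>\<^bsub>chain_group k J n X\<^esub> chain_class k J n X b
       = chain_class k J n X (a + b)"
  using normal.rcos_sum[OF normal_free_degenerate assms] by (simp add: chain_group_def FactGroup_def)

lemma chain_class_degenerate:
  assumes "d \<in> free_degenerate k J n X"
  shows "chain_class k J n X d = free_degenerate k J n X"
  using assms subgroup.subset[OF normal_imp_subgroup[OF normal_free_degenerate]]
  by (intro group.coset_join2 group_free_Abelian_group normal_imp_subgroup normal_free_degenerate) blast+

lemma one_chain_group: "\<one>\<^bsub>chain_group k J n X\<^esub> = free_degenerate k J n X"
  by (simp add: chain_group_def FactGroup_def)

text \<open>Turns the cycle condition on classes into degeneracy of the boundary of a representing
  chain.\<close>

lemma chain_class_eq_one:
  assumes "c \<in> carrier (free_cubes k J n X)" "chain_class k J n X c = \<one>\<^bsub>chain_group k J n X\<^esub>"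
  shows "c \<in> free_degenerate k J n X"
  by (rule group.coset_join1[OF group_free_Abelian_group assms(2)[unfolded one_chain_group] assms(1)
        normal_imp_subgroup[OF normal_free_degenerate]])

lemma free_boundary_hom:
  "free_boundary k J n \<in> hom (free_cubes k J n X) (free_cubes k J (n - 1) X)"
proof (rule homI)
  fix a assume "a \<in> carrier (free_cubes k J n X)"
  then show "free_boundary k J n a \<in> carrier (free_cubes k J (n - 1) X)"
    using free_boundary_singular by simp
qed (simp add: free_boundary_def frag_extend_add)

lemma free_map_hom:
  assumes "ccontinuous X Y f"
  shows "free_map k J n f \<in> hom (free_cubes k J n X) (free_cubes k J n Y)"
proof (rule homI)
  fix a assume "a \<in> carrier (free_cubes k J n X)"
  then show "free_map k J n f a \<in> carrier (free_cubes k J n Y)"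
    using free_map_singular[OF assms] by simp
qed (simp add: free_map_def frag_extend_add)

lemma free_boundary_free_degenerate:
  "free_boundary k J n ` free_degenerate k J n X \<subseteq> free_degenerate k J (n - 1) X"
  using free_boundary_degenerate[of _ n X] by (intro image_subsetI) simp

lemma free_map_free_degenerate:
  assumes "ccontinuous X Y f"
  shows "free_map k J n f ` free_degenerate k J n X \<subseteq> free_degenerate k J n Y"
  using free_map_degenerate[OF assms] by (intro image_subsetI) simp

lemma boundary_hom:
  "boundary k J n X \<in> hom (chain_group k J n X) (chain_group k J (n - 1) X)"
  unfolding boundary_def chain_group_def
  by (rule coset_map_hom[OF normal_free_degenerate normal_free_degenerate free_boundary_hom
        free_boundary_free_degenerate])

lemma boundary_chain_class:
  assumes "c \<in> carrier (free_cubes k J n X)"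
  shows "boundary k J n X (chain_class k J n X c) = chain_class k J (n - 1) X (free_boundary k J n c)"
  unfolding boundary_def
  by (intro coset_map_r_coset group_free_Abelian_group free_boundary_hom
      free_boundary_free_degenerate assms normal_imp_subgroup normal_free_degenerate)

lemma chain_map_induced_chain_class:
  assumes f: "ccontinuous X Y f" and "c \<in> carrier (free_cubes k J n X)"
  shows "chain_map_induced k J n Y f (chain_class k J n X c) = chain_class k J n Y (free_map k J n f c)"
  unfolding chain_map_induced_def
  by (intro coset_map_r_coset group_free_Abelian_group free_map_hom
      free_map_free_degenerate assms normal_imp_subgroup normal_free_degenerate)

lemma subgroup_boundaries: "subgroup (boundaries k J n X) (chain_group k J n X)"
proof -
  have "group_hom (chain_group k J (Suc n) X) (chain_group k J n X) (boundary k J (Suc n) X)"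
    using boundary_hom[of "Suc n" X] by (simp add: group_hom_def group_hom_axioms_def group_chain_group)
  then show ?thesis
    unfolding boundaries_def by (rule group_hom.img_is_subgroup)
qed

lemma chain_class_free_boundary_in_boundaries:
  assumes "b \<in> carrier (free_cubes k J (Suc n) X)"
  shows "chain_class k J n X (free_boundary k J (Suc n) b) \<in> boundaries k J n X"
  unfolding boundaries_def carrier_chain_group
  by (rule image_eqI[OF _ imageI[OF assms]]) (simp only: boundary_chain_class[OF assms] diff_Suc_1)

section \<open>Homotopy invariance\<close>

text \<open>Stated for all members \<open>\<partial> \<beta> + \<zeta>\<close> of a homology class: on \<open>\<partial> \<beta>\<close> the maps \<open>f\<close> and \<open>g\<close> both give
  boundaries since they commute with \<open>\<partial>\<close>, so \<open>\<partial> \<partial> = 0\<close> is never needed.\<close>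

lemma chain_map_induced_homologous:
  assumes X: "closure_space X" and f: "ccontinuous X Y f" and g: "ccontinuous X Y g"
    and H: "ccontinuous (tensor k X J) Y H"
    and Hf: "\<And>x. x \<in> pts X \<Longrightarrow> H (x, 0) = f x" and Hg: "\<And>x. x \<in> pts X \<Longrightarrow> H (x, 1) = g x"
    and \<beta>: "\<beta> \<in> carrier (chain_group k J (Suc n) X)"
    and \<zeta>: "\<zeta> \<in> carrier (cycle_group k J n X)"
  defines "\<alpha> \<equiv> boundary k J (Suc n) X \<beta> \<otimes>\<^bsub>chain_group k J n X\<^esub> \<zeta>"
  obtains \<gamma> where "\<gamma> \<in> boundaries k J n Y"
    and "chain_map_induced k J n Y f \<alpha>
       = \<gamma> \<otimes>\<^bsub>chain_group k J n Y\<^esub> chain_map_induced k J n Y g \<alpha>"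
    and "chain_map_induced k J n Y g \<alpha> \<in> carrier (chain_group k J n Y)"
proof -
  obtain b where b: "b \<in> carrier (free_cubes k J (Suc n) X)" "\<beta> = chain_class k J (Suc n) X b"
    using \<beta> unfolding carrier_chain_group by blast
  have \<zeta>': "\<zeta> \<in> carrier (chain_group k J n X)"
    "boundary k J n X \<zeta> = \<one>\<^bsub>chain_group k J (n - 1) X\<^esub>"
    using \<zeta> by (auto simp: cycle_group_def kernel_def)
  then obtain z where z: "z \<in> carrier (free_cubes k J n X)" "\<zeta> = chain_class k J n X z"
    unfolding carrier_chain_group by blast
  have bd: "free_boundary k J (Suc n) b \<in> carrier (free_cubes k J n X)"
    using b(1) free_boundary_singular[of b "Suc n" X] by simp
  \<comment> \<open>A free chain representing \<alpha>.\<close>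
  define a where "a = free_boundary k J (Suc n) b + z"
  have a: "a \<in> carrier (free_cubes k J n X)"
    using bd z(1) keys_add[of "free_boundary k J (Suc n) b" z] by (auto simp: a_def)
  have \<alpha>: "\<alpha> = chain_class k J n X a"
    using boundary_chain_class[OF b(1)] bd z by (simp add: \<alpha>_def b(2) a_def chain_class_add)
  have "free_boundary k J n z \<in> carrier (free_cubes k J (n - 1) X)"
    using z(1) free_boundary_singular by simp
  then have cycle: "free_boundary k J n z \<in> free_degenerate k J (n - 1) X"
    using \<zeta>'(2) boundary_chain_class[OF z(1)] by (intro chain_class_eq_one) (simp_all add: z(2))
  obtain c d where c: "Poly_Mapping.keys c \<subseteq> singular_cubes k J (Suc n) Y"
    and d: "Poly_Mapping.keys d \<subseteq> degenerate_cubes k J n Y"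
    and fz: "free_map k J n f z = free_boundary k J (Suc n) c + d + free_map k J n g z"
    by (rule free_map_homotopic_cycle[OF X H Hf Hg
          z(1)[unfolded carrier_free_Abelian_group_iff]
          cycle[unfolded carrier_free_Abelian_group_iff]])
  \<comment> \<open>Its boundary collects both sources of difference: the images of \<open>b\<close>
    under \<open>f\<close> and \<open>g\<close>, and the chain \<open>c\<close> from the homotopy
    applied to \<open>z\<close>.\<close>
  let ?e = "free_map k J (Suc n) f b - free_map k J (Suc n) g b + c"
  have e: "?e \<in> carrier (free_cubes k J (Suc n) Y)"
  proof -
    have "Poly_Mapping.keys (free_map k J (Suc n) f b - free_map k J (Suc n) g b)
        \<subseteq> singular_cubes k J (Suc n) Y"
      using free_map_singular[OF f] free_map_singular[OF g] b(1)
      by (intro order_trans[OF keys_diff] Un_least) simp_all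
    then show ?thesis
      using c unfolding carrier_free_Abelian_group_iff
      by (intro order_trans[OF keys_add] Un_least)
  qed
  have d': "d \<in> carrier (free_cubes k J n Y)"
    using d degenerate_subset_singular[of n Y] by auto
  have ga: "free_map k J n g a \<in> carrier (free_cubes k J n Y)"
    using free_map_singular[OF g] a by simp
  have be: "free_boundary k J (Suc n) ?e \<in> carrier (free_cubes k J n Y)"
    using free_boundary_singular[of ?e "Suc n" Y] e by simp
  have fa: "free_map k J n f a = free_boundary k J (Suc n) ?e + (d + free_map k J n g a)"
  proof -
    have "free_map k J n h a = free_boundary k J (Suc n) (free_map k J (Suc n) h b) + free_map k J n h z"
      for h :: "'a \<Rightarrow> 'b"
      by (simp add: a_def free_boundary_free_map) (simp add: free_map_def frag_extend_add)
    moreover have "free_boundary k J (Suc n) ?e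
        = free_boundary k J (Suc n) (free_map k J (Suc n) f b)
        - free_boundary k J (Suc n) (free_map k J (Suc n) g b) + free_boundary k J (Suc n) c"
      by (simp only: free_boundary_def frag_extend_add frag_extend_diff)
    ultimately show ?thesis
      using fz by simp
  qed
  have dga: "d + free_map k J n g a \<in> carrier (free_cubes k J n Y)"
    using d' ga unfolding carrier_free_Abelian_group_iff
    by (intro order_trans[OF keys_add] Un_least)
  \<comment> \<open>The degenerate error term disappears on passing to classes.\<close>
  have cls: "chain_class k J n Y (d + free_map k J n g a) = chain_class k J n Y (free_map k J n g a)"
  proof -
    have "chain_class k J n Y (d + free_map k J n g a)
        = \<one>\<^bsub>chain_group k J n Y\<^esub> \<otimes>\<^bsub>chain_group k J n Y\<^esub> chain_class k J n Y (free_map k J n g a)"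
      using chain_class_add[OF d' ga] chain_class_degenerate[of d n Y] d by (simp add: one_chain_group)
    also have "\<dots> = chain_class k J n Y (free_map k J n g a)"
      unfolding monoid.l_one[OF group.is_monoid[OF group_chain_group]
          imageI[OF ga, of "chain_class k J n Y", folded carrier_chain_group]] ..
    finally show ?thesis .
  qed
  have "chain_map_induced k J n Y f \<alpha> = chain_class k J n Y (free_map k J n f a)"
    unfolding \<alpha> by (rule chain_map_induced_chain_class[OF f a])
  also have "\<dots> = chain_class k J n Y (free_boundary k J (Suc n) ?e)
      \<otimes>\<^bsub>chain_group k J n Y\<^esub> chain_class k J n Y (d + free_map k J n g a)"
    unfolding fa by (rule chain_class_add[OF be dga, symmetric])
  also have "chain_class k J n Y (d + free_map k J n g a) = chain_map_induced k J n Y g \<alpha>"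
    unfolding \<alpha> chain_map_induced_chain_class[OF g a] by (rule cls)
  finally have "chain_map_induced k J n Y f \<alpha> = chain_class k J n Y (free_boundary k J (Suc n) ?e)
      \<otimes>\<^bsub>chain_group k J n Y\<^esub> chain_map_induced k J n Y g \<alpha>" .
  moreover have "chain_map_induced k J n Y g \<alpha> \<in> carrier (chain_group k J n Y)"
    using ga unfolding \<alpha> chain_map_induced_chain_class[OF g a] carrier_chain_group by blast
  ultimately show thesis
    using that chain_class_free_boundary_in_boundaries[OF e] by blast
qed

text \<open>The cycle group only shrinks the carrier, while cosets depend on the multiplication.
  Coset computations can thus take place in the chain group, where the boundaries form a
  subgroup.\<close>

lemma r_coset_cycle_group:
  "N #>\<^bsub>cycle_group k J n X\<^esub> a = N #>\<^bsub>chain_group k J n X\<^esub> a"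
  by (simp add: cycle_group_def r_coset_def)

lemma homology_induced_elementary_homotopy:
  assumes X: "closure_space X" and fg: "elementary_homotopy k J X Y f g"
    and z: "z \<in> carrier (cubical_homology k J n X)"
  shows "homology_induced k J n Y f z = homology_induced k J n Y g z"
proof -
  obtain H where f: "ccontinuous X Y f" and g: "ccontinuous X Y g"
    and H: "ccontinuous (tensor k X J) Y H"
    and "\<forall>x \<in> pts X. H (x, 0) = f x \<and> H (x, 1) = g x"
    using fg unfolding elementary_homotopy_def by blast
  then have Hf: "\<And>x. x \<in> pts X \<Longrightarrow> H (x, 0) = f x" and Hg: "\<And>x. x \<in> pts X \<Longrightarrow> H (x, 1) = g x"
    by blast+
  obtain \<zeta> where \<zeta>: "\<zeta> \<in> carrier (cycle_group k J n X)"
    and z_eq: "z = boundaries k J n X #>\<^bsub>chain_group k J n X\<^esub> \<zeta>"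
    using z by (auto simp: cubical_homology_def FactGroup_def RCOSETS_def r_coset_cycle_group)
  \<comment> \<open>The induced map is \<open>the_elem\<close> of an image over all members of the
    class \<open>z\<close>, so agreement at each member makes the two images equal.\<close>
  have "boundaries k J n Y #>\<^bsub>cycle_group k J n Y\<^esub> chain_map_induced k J n Y f \<alpha>
      = boundaries k J n Y #>\<^bsub>cycle_group k J n Y\<^esub> chain_map_induced k J n Y g \<alpha>"
    if \<alpha>: "\<alpha> \<in> z" for \<alpha>
  proof -
    obtain b where b: "b \<in> boundaries k J n X" "\<alpha> = b \<otimes>\<^bsub>chain_group k J n X\<^esub> \<zeta>"
      using \<alpha> by (auto simp: z_eq r_coset_def)
    obtain \<beta> where \<beta>: "\<beta> \<in> carrier (chain_group k J (Suc n) X)"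
      and b_eq: "b = boundary k J (Suc n) X \<beta>"
      using b(1) unfolding boundaries_def by (rule imageE)
    obtain \<gamma> where \<gamma>: "\<gamma> \<in> boundaries k J n Y"
      and fg: "chain_map_induced k J n Y f \<alpha>
         = \<gamma> \<otimes>\<^bsub>chain_group k J n Y\<^esub> chain_map_induced k J n Y g \<alpha>"
      and g\<alpha>: "chain_map_induced k J n Y g \<alpha> \<in> carrier (chain_group k J n Y)"
      unfolding b b_eq by (rule chain_map_induced_homologous[OF X f g H Hf Hg \<beta> \<zeta>])
    interpret C: group "chain_group k J n Y"
      by (rule group_chain_group)
    interpret B: subgroup "boundaries k J n Y" "chain_group k J n Y"
      by (rule subgroup_boundaries)
    have \<gamma>': "\<gamma> \<in> carrier (chain_group k J n Y)"
      using \<gamma> by (rule B.mem_carrier)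
    \<comment> \<open>The boundary \<gamma> by which the two images differ is absorbed into the
      coset.\<close>
    show ?thesis
      unfolding r_coset_cycle_group fg C.coset_mult_assoc[OF B.subset \<gamma>' g\<alpha>, symmetric]
        C.coset_join2[OF \<gamma>' B.subgroup_axioms \<gamma>] ..
  qed
  then show ?thesis
    unfolding homology_induced_def coset_map_def by (simp cong: image_cong)
qed

lemma homology_induced_homotopic:
  assumes X: "closure_space X" and fg: "homotopic k J X Y f g"
    and z: "z \<in> carrier (cubical_homology k J n X)"
  shows "homology_induced k J n Y f z = homology_induced k J n Y g z"
  using fg unfolding homotopic_def
proof (induction rule: equivclp_induct)
  \<comment> \<open>A step is an elementary homotopy in either direction; symmetry of equality
    covers both.\<close>
  case (step y w)
  then show ?case
    using homology_induced_elementary_homotopy[OF X _ z] by metis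
qed simp

end

theorem theorem5p5:
  fixes J :: "real cspace" and k :: prod_kind
    and X :: "'a cspace" and Y :: "'b cspace" and f g :: "'a \<Rightarrow> 'b"
  assumes "J \<in> {I_tau, J_top, J_plus}"
    and "closure_space X" and "closure_space Y"
    and "ccontinuous X Y f" and "ccontinuous X Y g"
    and "homotopic k J X Y f g"
  shows "\<forall>n. \<forall>z \<in> carrier (cubical_homology k J n X).
           homology_induced k J n Y f z = homology_induced k J n Y g z"
proof -
  \<comment> \<open>The locale predicate has \<open>J\<close> as its only argument, since its
    assumptions do not mention \<open>k\<close>; this covers both products.\<close>
  have "interval J"
    using assms(1) closure_space_I_tau closure_space_J_top closure_space_J_plus
    by (auto simp: interval_def I_tau_def J_top_def J_plus_def)
  then show ?thesis
    using interval.homology_induced_homotopic[OF _ assms(2,6)] by blast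
qed

end
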